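(* Let $X$ be a Tychonoff space and let $E$ be any set of functions with $L(X)\subseteq E\subseteq C(X_{\aleph_0})$, endowed with the topology of pointwise convergence. Then $hd(E)=hl^*(X_{\aleph_0})$.
   Context: All spaces are Tychonoff. A zero-set of $X$ is a set $\{x\in X: f(x)=0\}$ with $f:X\to\mathbb{R}$ continuous; $Z(X)$ is the family of all zero-sets of $X$. $X_{\aleph_0}$ is the set $X$ with the (Baire) topology having $Z(X)$ as a base. $C(X_{\aleph_0})$ is the set of all continuous real-valued functions on $X_{\aleph_0}$. $L(X)=\{n_1 f_{Z_1}+\dots+n_k f_{Z_k}: k\in\mathbb{N},\ n_i\in\mathbb{N},\ Z_i\in Z(X)\}$, where $f_Z$ is the characteristic function of $Z\subseteq X$. The topology of pointwise convergence on $E$ is the subspace topology from $\mathbb{R}^X$. $hd(Y)=\sup\{d(Z): Z\subseteq Y\}$ is the hereditary density ($d$ = density), $hl(Y)=\sup\{l(Z): Z\subseteq Y\}$ is the hereditary Lindelöf number ($l$ = Lindelöf number), and $hl^*(Y)=\sup\{hl(Y^n): n\in\mathbb{N}\}$. As is standard, values of cardinal functions are taken to be infinite cardinals (at least $\omega_0$). *)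

theory Defs
  imports "HOL-Analysis.Analysis"
begin

unbundle cardinal_syntax
no_notation Set_Algebras.elt_set_eq (infix "=o" 50)

text \<open>
  Cardinals are rendered as cardinal orders, as in the library's
  \<^theory>\<open>HOL.BNF_Cardinal_Order_Relation\<close>; they are compared across types by \<open>\<le>o\<close> and \<open>=o\<close>.
  The choices below are unique up to \<open>=o\<close>.
\<close>

lemma nonempty_if_mem: "x \<in> A \<Longrightarrow> A \<noteq> {}"
  by auto

definition card_min :: "'b rel set \<Rightarrow> 'b rel" where
  "card_min R = (SOME r. r \<in> R \<and> (\<forall>s\<in>R. r \<le>o s))"

text \<open>
  The upper bounds range over the cardinals represented on the same type; lemma \<open>card_sup_least\<close>
  shows that the result is below upper bounds on any other type as well.
\<close>

definition card_sup :: "'b rel set \<Rightarrow> 'b rel" where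
  "card_sup R = card_min {r :: 'b rel. Card_order r \<and> (\<forall>s\<in>R. s \<le>o r)}"

lemma card_min:
  assumes "R \<noteq> {}" "\<forall>r\<in>R. Card_order r"
  shows "card_min R \<in> R" and "\<And>s. s \<in> R \<Longrightarrow> card_min R \<le>o s"
proof -
  have "\<exists>r. r \<in> R \<and> (\<forall>s\<in>R. r \<le>o s)"
    using exists_minim_Card_order[OF assms] unfolding Bex_def .
  from someI_ex[OF this, folded card_min_def]
  show "card_min R \<in> R" "\<And>s. s \<in> R \<Longrightarrow> card_min R \<le>o s"
    by simp_all
qed

lemma Card_order_ordLeq_UNIV:
  fixes r :: "'b rel"
  assumes "Card_order r"
  shows "r \<le>o |UNIV :: 'b set|"
  by (rule ordIso_ordLeq_trans[OF ordIso_symmetric[OF card_of_Field_ordIso[OF assms]]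
        card_of_mono1[OF subset_UNIV]])

lemma card_sup:
  fixes R :: "'b rel set"
  assumes "\<forall>r\<in>R. Card_order r"
  shows "Card_order (card_sup R)"
    and "\<And>s. s \<in> R \<Longrightarrow> s \<le>o card_sup R"
    and "\<And>t :: 'b rel. \<lbrakk>Card_order t; \<forall>s\<in>R. s \<le>o t\<rbrakk> \<Longrightarrow> card_sup R \<le>o t"
proof -
  let ?U = "{r :: 'b rel. Card_order r \<and> (\<forall>s\<in>R. s \<le>o r)}"
  have "|UNIV :: 'b set| \<in> ?U"
    using assms card_of_Card_order[of "UNIV :: 'b set"] by (simp add: Card_order_ordLeq_UNIV)
  then have ne: "?U \<noteq> {}" by (rule nonempty_if_mem)
  have co: "\<forall>r\<in>?U. Card_order r" by simp
  note min = card_min[OF ne co, folded card_sup_def]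
  show "Card_order (card_sup R)" "\<And>s. s \<in> R \<Longrightarrow> s \<le>o card_sup R"
    using min(1) by simp_all
  show "\<And>t :: 'b rel. \<lbrakk>Card_order t; \<forall>s\<in>R. s \<le>o t\<rbrakk> \<Longrightarrow> card_sup R \<le>o t"
    by (rule min(2)) simp_all
qed

lemma card_sup_least:
  fixes R :: "'b rel set" and t :: "'c rel"
  assumes R: "\<forall>r\<in>R. Card_order r" and t: "Card_order t" and ub: "\<forall>s\<in>R. s \<le>o t"
  shows "card_sup R \<le>o t"
proof (rule ccontr)
  note c = card_sup(1)[OF R]
  assume "\<not> card_sup R \<le>o t"
  then have less: "t <o card_sup R"
    using not_ordLeq_iff_ordLess c t by (metis card_order_on_well_order_on)
  have "|Field t| \<le>o |UNIV :: 'b set|"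
    by (rule ordIso_ordLeq_trans[OF card_of_Field_ordIso[OF t]
          ordLeq_transitive[OF ordLess_imp_ordLeq[OF less] Card_order_ordLeq_UNIV[OF c]]])
  then obtain f :: "'c \<Rightarrow> 'b" where f: "inj_on f (Field t)"
    unfolding card_of_ordLeq[symmetric] by metis
  have iso: "t =o |f ` Field t|"
    by (rule ordIso_transitive[OF ordIso_symmetric[OF card_of_Field_ordIso[OF t]]
          card_of_ordIsoI[OF inj_on_imp_bij_betw[OF f]]])
  have "\<forall>s\<in>R. s \<le>o |f ` Field t|"
  proof
    fix s assume "s \<in> R"
    with ub have "s \<le>o t" ..
    from ordLeq_ordIso_trans[OF this iso] show "s \<le>o |f ` Field t|" .
  qed
  then have "card_sup R \<le>o |f ` Field t|"
    by (rule card_sup(3)[OF R card_of_Card_order])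
  from ordLeq_ordIso_trans[OF this ordIso_symmetric[OF iso]]
  have "card_sup R \<le>o t" .
  then show False
    using not_ordLess_ordLeq[OF less] by (rule notE[rotated])
qed

text \<open>
  Cardinal functions of a space with points in \<^typ>\<open>'b\<close> take values on the type \<^typ>\<open>'b + nat\<close>, which
  has room for every infinite cardinal up to \<open>max |X| \<omega>\<close>. Values are infinite:
  \<open>|D| +c natLeq\<close> is the cardinal \<open>|D| + \<omega>\<close>.
\<close>

definition density :: "'b topology \<Rightarrow> ('b + nat) rel" where
  "density Y = card_min ((\<lambda>D. |D| +c natLeq) ` {D. D \<subseteq> topspace Y \<and> Y closure_of D = topspace Y})"

definition lindelof_number :: "'b topology \<Rightarrow> ('b + nat) rel" where
  "lindelof_number Y = card_min {\<kappa>. Card_order \<kappa> \<and> natLeq \<le>o \<kappa> \<and>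
     (\<forall>\<U>. (\<forall>U\<in>\<U>. openin Y U) \<and> \<Union>\<U> = topspace Y
        \<longrightarrow> (\<exists>\<V>. |\<V>| \<le>o \<kappa> \<and> \<V> \<subseteq> \<U> \<and> \<Union>\<V> = topspace Y))}"

definition hereditary_density :: "'b topology \<Rightarrow> ('b + nat) rel" where
  "hereditary_density Y = card_sup {density (subtopology Y S) | S. S \<subseteq> topspace Y}"

definition hereditary_lindelof :: "'b topology \<Rightarrow> ('b + nat) rel" where
  "hereditary_lindelof Y = card_sup {lindelof_number (subtopology Y S) | S. S \<subseteq> topspace Y}"

definition power_space :: "'b topology \<Rightarrow> nat \<Rightarrow> (nat \<Rightarrow> 'b) topology" where
  "power_space Y n = product_topology (\<lambda>_. Y) {..<n}"

definition hereditary_lindelof_star :: "'b topology \<Rightarrow> ((nat \<Rightarrow> 'b) + nat) rel" where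
  "hereditary_lindelof_star Y = card_sup {hereditary_lindelof (power_space Y n) | n. n \<ge> 1}"

lemma density_attained:
  "\<exists>D. D \<subseteq> topspace Y \<and> Y closure_of D = topspace Y \<and> density Y = |D| +c natLeq"
  "\<And>D. \<lbrakk>D \<subseteq> topspace Y; Y closure_of D = topspace Y\<rbrakk> \<Longrightarrow> density Y \<le>o |D| +c natLeq"
proof -
  let ?D = "{D. D \<subseteq> topspace Y \<and> Y closure_of D = topspace Y}"
  let ?R = "(\<lambda>D. |D| +c natLeq) ` ?D"
  have "topspace Y \<in> ?D" by simp
  then have ne: "?R \<noteq> {}" by (rule nonempty_if_mem[OF imageI])
  have co: "\<forall>r\<in>?R. Card_order r" by (simp add: Card_order_csum)
  have "density Y \<in> ?R"
    unfolding density_def by (rule card_min(1)[OF ne co])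
  then show "\<exists>D. D \<subseteq> topspace Y \<and> Y closure_of D = topspace Y \<and> density Y = |D| +c natLeq"
    by (elim imageE) auto
  show "density Y \<le>o |D| +c natLeq" if "D \<subseteq> topspace Y" "Y closure_of D = topspace Y" for D
    unfolding density_def using that by (intro card_min(2)[OF ne co] imageI) simp
qed

lemma lindelof_number_attained:
  fixes Y :: "'b topology"
  defines "K \<equiv> {\<kappa> :: ('b + nat) rel. Card_order \<kappa> \<and> natLeq \<le>o \<kappa> \<and>
     (\<forall>\<U>. (\<forall>U\<in>\<U>. openin Y U) \<and> \<Union>\<U> = topspace Y
        \<longrightarrow> (\<exists>\<V>. |\<V>| \<le>o \<kappa> \<and> \<V> \<subseteq> \<U> \<and> \<Union>\<V> = topspace Y))}"
  shows "lindelof_number Y \<in> K" and "\<And>\<kappa>. \<kappa> \<in> K \<Longrightarrow> lindelof_number Y \<le>o \<kappa>"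
proof -
  let ?k = "|UNIV :: 'b set| +c natLeq :: ('b + nat) rel"
  have 1: "|topspace Y| \<le>o ?k"
    by (rule ordLeq_transitive[OF card_of_mono1[OF subset_UNIV] ordLeq_csum1[OF card_of_Card_order]])
  have 2: "natLeq \<le>o ?k"
    by (rule ordLeq_csum2[OF natLeq_Card_order])
  have 3: "\<exists>\<V>. |\<V>| \<le>o ?k \<and> \<V> \<subseteq> \<U> \<and> \<Union>\<V> = topspace Y" if "\<Union>\<U> = topspace Y" for \<U>
  proof -
    have "\<forall>x\<in>topspace Y. \<exists>U. U \<in> \<U> \<and> x \<in> U"
      unfolding that[symmetric] by blast
    from bchoice[OF this] obtain g where g: "\<forall>x\<in>topspace Y. g x \<in> \<U> \<and> x \<in> g x" ..
    have "|g ` topspace Y| \<le>o ?k"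
      by (rule ordLeq_transitive[OF card_of_image 1])
    moreover have "g ` topspace Y \<subseteq> \<U>" "\<Union>(g ` topspace Y) = topspace Y"
      using g that by blast+
    ultimately show ?thesis by blast
  qed
  have ne: "K \<noteq> {}"
  proof -
    have "?k \<in> K" unfolding K_def using 2 3 by (simp add: Card_order_csum)
    then show ?thesis by (rule nonempty_if_mem)
  qed
  have co: "\<forall>r\<in>K. Card_order r" unfolding K_def by simp
  have eq: "lindelof_number Y = card_min K" unfolding lindelof_number_def K_def ..
  show "lindelof_number Y \<in> K" and "\<And>\<kappa>. \<kappa> \<in> K \<Longrightarrow> lindelof_number Y \<le>o \<kappa>"
    unfolding eq by (rule card_min[OF ne co], assumption?)+
qed

definition zero_sets :: "'a topology \<Rightarrow> 'a set set" where
  "zero_sets X = {{x \<in> topspace X. f x = 0} | f. continuous_map X euclideanreal f}"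

definition baire_space :: "'a topology \<Rightarrow> 'a topology" where
  "baire_space X = topology (arbitrary union_of (\<lambda>Z. Z \<in> zero_sets X))"

lemma zero_sets_Int:
  assumes "S \<in> zero_sets X" "T \<in> zero_sets X"
  shows "S \<inter> T \<in> zero_sets X"
proof -
  from assms obtain f g where
    f: "continuous_map X euclideanreal f" "S = {x \<in> topspace X. f x = 0}" and
    g: "continuous_map X euclideanreal g" "T = {x \<in> topspace X. g x = 0}"
    unfolding zero_sets_def by blast
  have "continuous_map X euclideanreal (\<lambda>x. \<bar>f x\<bar> + \<bar>g x\<bar>)"
    by (intro continuous_map_add continuous_map_real_abs f g)
  moreover have "S \<inter> T = {x \<in> topspace X. \<bar>f x\<bar> + \<bar>g x\<bar> = 0}"
    unfolding f g by auto
  ultimately show ?thesis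
    unfolding zero_sets_def by (intro CollectI exI[of _ "\<lambda>x. \<bar>f x\<bar> + \<bar>g x\<bar>"] conjI)
qed

lemma openin_baire_space:
  "openin (baire_space X) = arbitrary union_of (\<lambda>Z. Z \<in> zero_sets X)"
  unfolding baire_space_def
  by (intro topology_inverse' istopology_base zero_sets_Int)

lemma topspace_baire_space: "topspace (baire_space X) = topspace X"
proof
  show "topspace (baire_space X) \<subseteq> topspace X"
    unfolding topspace_def[of "baire_space X"] openin_baire_space
    by (auto simp: union_of_def zero_sets_def)
  have "topspace X \<in> zero_sets X"
    unfolding zero_sets_def by (rule CollectI, rule exI[of _ "\<lambda>_. 0"]) simp
  then have "openin (baire_space X) (topspace X)"
    unfolding openin_baire_space by (rule arbitrary_union_of_inc)
  then show "topspace X \<subseteq> topspace (baire_space X)"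
    by (rule openin_subset)
qed

text \<open>
  Real functions on a space are represented by their extensional representatives, i.e. as points of
  \<^term>\<open>powertop_real (topspace X)\<close>.
\<close>

definition continuous_functions :: "'a topology \<Rightarrow> ('a \<Rightarrow> real) set" where
  "continuous_functions Y = {f \<in> extensional (topspace Y). continuous_map Y euclideanreal f}"

text \<open>Coefficients and number of summands are positive; allowing \<open>0\<close> would give the same set, as
  \<open>{}\<close> is a zero-set.\<close>

definition L_functions :: "'a topology \<Rightarrow> ('a \<Rightarrow> real) set" where
  "L_functions X =
     {restrict (\<lambda>x. \<Sum>i<k. real (n i) * indicator (Z i) x) (topspace X) | (k :: nat) n Z.
        k \<ge> 1 \<and> (\<forall>i<k. n i \<ge> 1 \<and> Z i \<in> zero_sets X)}"

definition pointwise_topology :: "'a topology \<Rightarrow> ('a \<Rightarrow> real) set \<Rightarrow> ('a \<Rightarrow> real) topology" where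
  "pointwise_topology X E = subtopology (powertop_real (topspace X)) E"

definition tychonoff_space :: "'a topology \<Rightarrow> bool" where
  "tychonoff_space X \<longleftrightarrow> completely_regular_space X \<and> Hausdorff_space X"

end

theory Submission
  imports Defs "HOL-Library.Countable_Set_Type" "HOL-Library.Nat_Bijection"
begin

text \<open>
  Write \<open>Y\<close> for the Baire space of \<open>X\<close>. Both inequalities translate a covering of subsets of \<open>Y\<^sup>n\<close>
  into approximation of functions, the point being that a basic neighbourhood of \<open>f\<close> in the topology
  of pointwise convergence restricts the values of \<open>f\<close> at the coordinates of some tuple
  \<open>x \<in> Y\<^sup>n\<close>.

  For \<open>hd(E) \<le> hl\<^sup>*(Y)\<close>, given \<open>S \<subseteq> E\<close> and a list \<open>O\<^sub>1, \<dots>, O\<^sub>n\<close> of rational intervals, the sets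
  \<open>{x \<in> Y\<^sup>n. \<forall>i. f (x\<^sub>i) \<in> O\<^sub>i}\<close> for \<open>f \<in> S\<close> are open, so at most \<open>hl(Y\<^sup>n)\<close> of them already have the
  same union. There are only countably many lists of rational intervals, and the functions selected
  for all of them together form a dense subset of \<open>S\<close>
  (\<open>hereditary_density_le_hereditary_lindelof_star\<close>). This holds for continuous functions on
  an arbitrary space.

  For \<open>hl\<^sup>*(Y) \<le> hd(E)\<close>, let open sets cover \<open>A \<subseteq> Y\<^sup>n\<close>. Around each \<open>a \<in> A\<close> choose a box
  \<open>Z\<^sub>1 \<times> \<dots> \<times> Z\<^sub>n\<close> of zero-sets inside one of them, and code the box by the single function
  \<open>f\<^sub>a = \<Sum>\<^sub>i 2\<^sup>i f\<^bsub>Z\<^sub>i\<^esub> \<in> L(X)\<close>: the binary digits of \<open>f\<^sub>a y\<close> say which sides of the box contain \<open>y\<close>.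
  If \<open>f\<^sub>a\<close> is close to \<open>f\<^sub>b\<close> at the coordinates of \<open>b\<close>, then these integer values agree, and since
  the \<open>i\<close>-th digit of \<open>f\<^sub>b (b\<^sub>i)\<close> is \<open>1\<close>, so is that of \<open>f\<^sub>a (b\<^sub>i)\<close>; hence \<open>b\<close> lies in the box of
  \<open>a\<close>. So a dense subset of \<open>{f\<^sub>a. a \<in> A}\<close> gives a subcover of no larger size
  (\<open>hereditary_lindelof_star_le_hereditary_density\<close>).
\<close>

section \<open>Cardinals on different types\<close>

text \<open>
  The cardinal functions are minima over cardinals represented on one fixed type. This moves a bound
  found on another type into that type.
\<close>

lemma Card_order_transfer:
  fixes t :: "'c rel" and r :: "'b rel"
  assumes "Card_order t" "t \<le>o r" "Card_order r"
  obtains t' :: "'b rel" where "Card_order t'" "t' =o t"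
proof -
  have "|Field t| \<le>o |UNIV :: 'b set|"
    by (rule ordIso_ordLeq_trans[OF card_of_Field_ordIso[OF assms(1)]
          ordLeq_transitive[OF assms(2) Card_order_ordLeq_UNIV[OF assms(3)]]])
  then obtain f :: "'c \<Rightarrow> 'b" where f: "inj_on f (Field t)"
    unfolding card_of_ordLeq[symmetric] by metis
  have "|f ` Field t| =o t"
    by (rule ordIso_symmetric[OF ordIso_transitive[OF
          ordIso_symmetric[OF card_of_Field_ordIso[OF assms(1)]]
          card_of_ordIsoI[OF inj_on_imp_bij_betw[OF f]]]])
  then show thesis
    using that card_of_Card_order by blast
qed

section \<open>Lindelof numbers and densities as bounds\<close>

lemma lindelof_number_props:
  fixes Y :: "'b topology"
  shows "Card_order (lindelof_number Y)" "natLeq \<le>o lindelof_number Y"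
    and "\<lbrakk>\<And>U. U \<in> \<U> \<Longrightarrow> openin Y U; \<Union>\<U> = topspace Y\<rbrakk>
      \<Longrightarrow> \<exists>\<V>. |\<V>| \<le>o lindelof_number Y \<and> \<V> \<subseteq> \<U> \<and> \<Union>\<V> = topspace Y"
  using lindelof_number_attained(1)[of Y] by auto

lemma lindelof_number_least:
  fixes Y :: "'b topology" and t :: "'c rel"
  assumes t: "Card_order t" "natLeq \<le>o t"
    and sub: "\<And>\<U>. \<lbrakk>\<And>U. U \<in> \<U> \<Longrightarrow> openin Y U; \<Union>\<U> = topspace Y\<rbrakk>
      \<Longrightarrow> \<exists>\<V>. |\<V>| \<le>o t \<and> \<V> \<subseteq> \<U> \<and> \<Union>\<V> = topspace Y"
  shows "lindelof_number Y \<le>o t"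
proof (rule ccontr)
  assume "\<not> lindelof_number Y \<le>o t"
  then have less: "t <o lindelof_number Y"
    using not_ordLeq_iff_ordLess lindelof_number_props(1) t(1)
    by (metis card_order_on_well_order_on)
  obtain t' :: "('b + nat) rel" where t': "Card_order t'" "t' =o t"
    using Card_order_transfer[OF t(1) ordLess_imp_ordLeq[OF less] lindelof_number_props(1)] .
  note iso = ordIso_symmetric[OF t'(2)]
  have "lindelof_number Y \<le>o t'"
  proof (rule lindelof_number_attained(2), intro CollectI conjI allI impI)
    show "Card_order t'" by (fact t'(1))
    show "natLeq \<le>o t'" by (rule ordLeq_ordIso_trans[OF t(2) iso])
    fix \<U> assume "(\<forall>U\<in>\<U>. openin Y U) \<and> \<Union>\<U> = topspace Y"
    then obtain \<V> where V: "|\<V>| \<le>o t" "\<V> \<subseteq> \<U>" "\<Union>\<V> = topspace Y"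
      using sub[of \<U>] by metis
    show "\<exists>\<V>. |\<V>| \<le>o t' \<and> \<V> \<subseteq> \<U> \<and> \<Union>\<V> = topspace Y"
      by (intro exI[of _ \<V>] conjI ordLeq_ordIso_trans[OF V(1) iso] V(2,3))
  qed
  from ordLeq_ordIso_trans[OF this t'(2)] show False
    using not_ordLess_ordLeq[OF less] by blast
qed

lemma hereditary_lindelof_props:
  shows "Card_order (hereditary_lindelof Y)" "natLeq \<le>o hereditary_lindelof Y"
    and "S \<subseteq> topspace Y \<Longrightarrow> lindelof_number (subtopology Y S) \<le>o hereditary_lindelof Y"
proof -
  let ?R = "{lindelof_number (subtopology Y S) | S. S \<subseteq> topspace Y}"
  have co: "\<forall>r\<in>?R. Card_order r"
    using lindelof_number_props(1) by blast
  note sup = card_sup[OF co, folded hereditary_lindelof_def]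
  show "Card_order (hereditary_lindelof Y)" by (fact sup(1))
  show le: "lindelof_number (subtopology Y S) \<le>o hereditary_lindelof Y" if "S \<subseteq> topspace Y" for S
    using that by (intro sup(2)) blast
  show "natLeq \<le>o hereditary_lindelof Y"
    by (rule ordLeq_transitive[OF lindelof_number_props(2) le[OF empty_subsetI]])
qed

text \<open>
  In a hereditary setting no covering condition is needed: a family of open sets covers its own
  union, which is a subspace.
\<close>

lemma hereditary_lindelof_subfamily:
  assumes "\<And>i. i \<in> I \<Longrightarrow> openin Y (U i)"
  obtains J where "J \<subseteq> I" "|J| \<le>o hereditary_lindelof Y" "\<Union>(U ` J) = \<Union>(U ` I)"
proof -
  let ?W = "\<Union>(U ` I)"
  have W: "?W \<subseteq> topspace Y"
    using assms openin_subset by blast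
  then have top: "topspace (subtopology Y ?W) = ?W"
    by (rule topspace_subtopology_subset)
  have "openin (subtopology Y ?W) V" if "V \<in> U ` I" for V
    using that assms by (auto intro!: subset_openin_subtopology)
  from lindelof_number_props(3)[OF this, of "U ` I"] obtain \<V>
    where V: "|\<V>| \<le>o lindelof_number (subtopology Y ?W)" "\<V> \<subseteq> U ` I" "\<Union>\<V> = ?W"
    unfolding top by auto
  then obtain J where J: "J \<subseteq> I" "inj_on U J" "\<V> = U ` J"
    unfolding subset_image_inj by blast
  have "|J| \<le>o |\<V>|"
    using J card_of_ordLeq[of J \<V>] by blast
  from ordLeq_transitive[OF this ordLeq_transitive[OF V(1) hereditary_lindelof_props(3)[OF W]]]
  show thesis using that J V by blast
qed

lemma hereditary_lindelof_star_props:
  shows "Card_order (hereditary_lindelof_star Y)" "natLeq \<le>o hereditary_lindelof_star Y"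
    and "n \<ge> 1 \<Longrightarrow> hereditary_lindelof (power_space Y n) \<le>o hereditary_lindelof_star Y"
proof -
  let ?R = "{hereditary_lindelof (power_space Y n) | n. n \<ge> 1}"
  have co: "\<forall>r\<in>?R. Card_order r"
    using hereditary_lindelof_props(1) by blast
  note sup = card_sup[OF co, folded hereditary_lindelof_star_def]
  show "Card_order (hereditary_lindelof_star Y)" by (fact sup(1))
  show le: "hereditary_lindelof (power_space Y n) \<le>o hereditary_lindelof_star Y" if "n \<ge> 1" for n
    using that by (intro sup(2)) blast
  show "natLeq \<le>o hereditary_lindelof_star Y"
    by (rule ordLeq_transitive[OF hereditary_lindelof_props(2) le[OF order_refl]])
qed

lemma density_Card_order: "Card_order (density Y)"
  using density_attained(1)[of Y] Card_order_csum by auto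

lemma natLeq_le_density: "natLeq \<le>o density Y"
  using density_attained(1)[of Y] ordLeq_csum2[OF natLeq_Card_order] by auto

lemma density_le:
  assumes "D \<subseteq> topspace Y" "Y closure_of D = topspace Y"
    and "|D| \<le>o \<kappa>" "natLeq \<le>o \<kappa>" "Card_order \<kappa>"
  shows "density Y \<le>o \<kappa>"
proof -
  have "Cinfinite \<kappa>"
    using cinfinite_mono[OF assms(4) natLeq_cinfinite] assms(5) by blast
  from csum_cinfinite_bound[OF assms(3,4) card_of_Card_order natLeq_Card_order this]
  show ?thesis
    by (rule ordLeq_transitive[OF density_attained(2)[OF assms(1,2)]])
qed

lemma hereditary_density_props:
  shows "Card_order (hereditary_density Y)" "natLeq \<le>o hereditary_density Y"
    and "S \<subseteq> topspace Y \<Longrightarrow> density (subtopology Y S) \<le>o hereditary_density Y"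
proof -
  let ?R = "{density (subtopology Y S) | S. S \<subseteq> topspace Y}"
  have co: "\<forall>r\<in>?R. Card_order r"
    using density_Card_order by blast
  note sup = card_sup[OF co, folded hereditary_density_def]
  show "Card_order (hereditary_density Y)" by (fact sup(1))
  show le: "density (subtopology Y S) \<le>o hereditary_density Y" if "S \<subseteq> topspace Y" for S
    using that by (intro sup(2)) blast
  show "natLeq \<le>o hereditary_density Y"
    by (rule ordLeq_transitive[OF natLeq_le_density le[OF empty_subsetI]])
qed

lemma hereditary_density_dense_subset:
  assumes "S \<subseteq> topspace Y"
  obtains D where "D \<subseteq> S" "|D| \<le>o hereditary_density Y" "S \<subseteq> Y closure_of D"
proof -
  have top: "topspace (subtopology Y S) = S"
    using assms by (rule topspace_subtopology_subset)
  from density_attained(1)[of "subtopology Y S"] obtain D where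
    D: "D \<subseteq> S" "subtopology Y S closure_of D = S" "density (subtopology Y S) = |D| +c natLeq"
    unfolding top by blast
  have "|D| \<le>o density (subtopology Y S)"
    unfolding D(3) by (rule ordLeq_csum1[OF card_of_Card_order])
  from ordLeq_transitive[OF this hereditary_density_props(3)[OF assms]]
  show thesis
    using that D(1,2) closure_of_subtopology_subset[of Y S D] by blast
qed

section \<open>Density of function spaces from covers of powers\<close>

lemma rational_interval_in_open:
  fixes U :: "real set"
  assumes "open U" "y \<in> U"
  obtains p q :: rat where "y \<in> {of_rat p<..<of_rat q}" "{of_rat p<..<of_rat q} \<subseteq> U"
proof -
  obtain e where e: "e > 0" "ball y e \<subseteq> U"
    using assms open_contains_ball by blast
  obtain p :: rat where p: "y - e < of_rat p" "of_rat p < y"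
    using of_rat_dense[of "y - e" y] e(1) by auto
  obtain q :: rat where q: "y < of_rat q" "of_rat q < y + e"
    using of_rat_dense[of y "y + e"] e(1) by auto
  have "{of_rat p<..<of_rat q} \<subseteq> ball y e"
    using p q by (auto simp: dist_real_def)
  then show thesis
    using that[of p q] p q e(2) by auto
qed

text \<open>
  \<open>hits f x\<close> can be read in two ways: as membership of \<open>x\<close> in an open subset of \<open>Y\<^sup>n\<close> determined by
  \<open>f\<close>, or as membership of \<open>f\<close> in a basic neighbourhood determined by \<open>x\<close>. Under the first reading
  \<open>hl(Y\<^sup>n)\<close> bounds the number of functions needed; under the second, these functions meet every
  neighbourhood of this shape that \<open>S\<close> meets.
\<close>

lemma few_functions_for_intervals:
  fixes Y :: "'b topology" and os :: "(rat \<times> rat) list"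
  assumes S: "S \<subseteq> continuous_functions Y"
  defines "hits \<equiv> \<lambda>(f :: 'b \<Rightarrow> real) x. \<forall>i<length os.
    f (x i) \<in> {of_rat (fst (os ! i))<..<of_rat (snd (os ! i))}"
  shows "\<exists>J\<subseteq>S. |J| \<le>o hereditary_lindelof_star Y \<and>
    (\<forall>x\<in>PiE {..<length os} (\<lambda>_. topspace Y). (\<exists>f\<in>S. hits f x) \<longrightarrow> (\<exists>f\<in>J. hits f x))"
proof (cases "os = [] \<or> S = {}")
  case True
  \<comment> \<open>The empty list bounds nothing, and \<open>Y\<^sup>0\<close> is not among the powers in \<open>hl\<^sup>*\<close>; any one function
    serves.\<close>
  show ?thesis
  proof (cases "S = {}")
    case False
    then obtain s where s: "s \<in> S" by blast
    have "|{s}| \<le>o hereditary_lindelof_star Y"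
      by (rule ordLeq_transitive[OF _ hereditary_lindelof_star_props(2)])
        (simp flip: countable_card_le_natLeq)
    then show ?thesis
      using s True False by (intro exI[of _ "{s}"]) (auto simp: hits_def)
  next
    case True
    have "|{} :: ('b \<Rightarrow> real) set| \<le>o hereditary_lindelof_star Y"
      by (rule ordLeq_transitive[OF _ hereditary_lindelof_star_props(2)])
        (simp flip: countable_card_le_natLeq)
    with True show ?thesis by blast
  qed
next
  case False
  let ?n = "length os" and ?I = "\<lambda>i. {of_rat (fst (os ! i))<..<of_rat (snd (os ! i)) :: real}"
  define U where "U f = PiE {..<?n} (\<lambda>i. {y \<in> topspace Y. f y \<in> ?I i})" for f :: "'b \<Rightarrow> real"
  have "openin (power_space Y ?n) (U f)" if "f \<in> S" for f
  proof -
    have "continuous_map Y euclideanreal f"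
      using that S by (auto simp: continuous_functions_def)
    then have "openin Y {y \<in> topspace Y. f y \<in> ?I i}" for i
      by (rule openin_continuous_map_preimage) (simp flip: open_openin)
    then show ?thesis
      unfolding power_space_def U_def by (simp add: openin_PiE)
  qed
  then obtain J where J: "J \<subseteq> S" "|J| \<le>o hereditary_lindelof (power_space Y ?n)"
      "\<Union>(U ` J) = \<Union>(U ` S)"
    using hereditary_lindelof_subfamily[of S "power_space Y ?n" U] by blast
  have U: "x \<in> U f \<longleftrightarrow> hits f x" if "x \<in> PiE {..<?n} (\<lambda>_. topspace Y)" for f x
    using that by (auto simp: U_def hits_def PiE_iff)
  have "?n \<ge> 1" using False by (simp add: Suc_le_eq)
  then have "|J| \<le>o hereditary_lindelof_star Y"
    using J(2) hereditary_lindelof_star_props(3) ordLeq_transitive by blast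
  moreover have "(\<exists>f\<in>S. hits f x) \<longrightarrow> (\<exists>f\<in>J. hits f x)"
    if "x \<in> PiE {..<?n} (\<lambda>_. topspace Y)" for x
    using J(3) U[OF that] by blast
  ultimately show ?thesis using J(1) by blast
qed

theorem hereditary_density_le_hereditary_lindelof_star:
  fixes Y :: "'b topology"
  assumes E: "E \<subseteq> continuous_functions Y"
  shows "hereditary_density (pointwise_topology Y E) \<le>o hereditary_lindelof_star Y"
  unfolding hereditary_density_def
proof (rule card_sup_least)
  show "\<forall>r\<in>{density (subtopology (pointwise_topology Y E) S) |S.
      S \<subseteq> topspace (pointwise_topology Y E)}. Card_order r"
    using density_Card_order by blast
  show "Card_order (hereditary_lindelof_star Y)"
    by (rule hereditary_lindelof_star_props)
  show "\<forall>r\<in>{density (subtopology (pointwise_topology Y E) S) |S.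
      S \<subseteq> topspace (pointwise_topology Y E)}. r \<le>o hereditary_lindelof_star Y"
  proof clarify
    fix S assume "S \<subseteq> topspace (pointwise_topology Y E)"
    then have SE: "S \<subseteq> E" and Stop: "S \<subseteq> topspace (powertop_real (topspace Y))"
      by (auto simp: pointwise_topology_def)
    let ?T = "powertop_real (topspace Y)"
    have sub: "subtopology (pointwise_topology Y E) S = subtopology ?T S"
      using SE by (simp add: pointwise_topology_def subtopology_subtopology Int_absorb1)
    let ?hits = "\<lambda>os (f :: 'b \<Rightarrow> real) x. \<forall>i<length os.
      f (x i) \<in> {of_rat (fst (os ! i))<..<of_rat (snd (os ! i))}"
    have "\<forall>os. \<exists>J\<subseteq>S. |J| \<le>o hereditary_lindelof_star Y \<and>
      (\<forall>x\<in>PiE {..<length os} (\<lambda>_. topspace Y).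
        (\<exists>f\<in>S. ?hits os f x) \<longrightarrow> (\<exists>f\<in>J. ?hits os f x))"
      using few_functions_for_intervals[of S Y] SE E by blast
    then obtain J where J: "\<And>os. J os \<subseteq> S" "\<And>os. |J os| \<le>o hereditary_lindelof_star Y"
      "\<And>os x f. \<lbrakk>x \<in> PiE {..<length os} (\<lambda>_. topspace Y); f \<in> S; ?hits os f x\<rbrakk>
        \<Longrightarrow> \<exists>f\<in>J os. ?hits os f x"
      by metis
    define D where "D = (\<Union>os. J os)"
    have DS: "D \<subseteq> S" using J(1) by (auto simp: D_def)
    have inf: "\<not> finite (Field (hereditary_lindelof_star Y))"
      using cinfinite_mono[OF hereditary_lindelof_star_props(2) natLeq_cinfinite]
      by (simp add: cinfinite_def)
    have "|UNIV :: (rat \<times> rat) list set| \<le>o natLeq"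
      by (simp flip: countable_card_le_natLeq)
    from ordLeq_transitive[OF this hereditary_lindelof_star_props(2)]
    have card: "|D| \<le>o hereditary_lindelof_star Y"
      unfolding D_def using J(2)
      by (intro card_of_UNION_ordLeq_infinite_Field inf hereditary_lindelof_star_props) auto
    have "f \<in> ?T closure_of D" if f: "f \<in> S" for f
      unfolding in_closure_of
    proof (intro conjI allI impI)
      show "f \<in> topspace ?T" using f Stop by blast
      fix T assume T: "f \<in> T \<and> openin ?T T"
      then obtain V where V: "f \<in> PiE (topspace Y) V" "\<And>y. open (V y)"
          "finite {y. V y \<noteq> UNIV}" "PiE (topspace Y) V \<subseteq> T"
        using product_topology_open_contains_basis[of "\<lambda>_. euclideanreal" "topspace Y" T f]
        by (auto simp flip: open_openin)
      have "\<forall>y\<in>topspace Y. \<exists>p q :: rat. f y \<in> {of_rat p<..<of_rat q} \<and> {of_rat p<..<of_rat q} \<subseteq> V y"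
        using V(1,2) rational_interval_in_open by (metis PiE_mem)
      then obtain p q :: "'b \<Rightarrow> rat" where pq: "\<And>y. y \<in> topspace Y \<Longrightarrow>
          f y \<in> {of_rat (p y)<..<of_rat (q y)} \<and> {of_rat (p y)<..<of_rat (q y)} \<subseteq> V y"
        by metis
      have "finite {y \<in> topspace Y. V y \<noteq> UNIV}"
        using V(3) by (rule rev_finite_subset) auto
      then obtain xs where xs: "set xs = {y \<in> topspace Y. V y \<noteq> UNIV}"
        using finite_list by blast
      \<comment> \<open>The finitely many restricted coordinates, listed, become a tuple in a power of \<open>Y\<close>.\<close>
      define os where "os = map (\<lambda>y. (p y, q y)) xs"
      define x where "x = restrict (\<lambda>i. xs ! i) {..<length os}"
      have xi: "x i = xs ! i \<and> xs ! i \<in> topspace Y" if "i < length xs" for i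
        using that nth_mem[OF that] xs by (auto simp: x_def os_def)
      have "x \<in> PiE {..<length os} (\<lambda>_. topspace Y)"
        using xi by (auto simp: x_def os_def)
      moreover have "?hits os f x"
        using pq xi by (auto simp: os_def)
      ultimately obtain g where g: "g \<in> J os" "?hits os g x"
        using J(3) f by blast
      have "g y \<in> V y" if "y \<in> topspace Y" for y
      proof (cases "V y = UNIV")
        case False
        with that xs obtain i where i: "i < length xs" "xs ! i = y"
          by (metis (mono_tags, lifting) in_set_conv_nth mem_Collect_eq)
        with g(2) xi have "g y \<in> {of_rat (p y)<..<of_rat (q y)}"
          by (auto simp: os_def)
        then show ?thesis using pq[OF that] by blast
      qed simp
      moreover have "g \<in> extensional (topspace Y)"
        using g(1) J(1) SE E by (auto simp: continuous_functions_def)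
      ultimately have "g \<in> PiE (topspace Y) V" by (simp add: PiE_iff)
      then have "g \<in> T" using V(4) by blast
      then show "\<exists>g. g \<in> D \<and> g \<in> T" using g(1) by (auto simp: D_def)
    qed
    then have dense: "subtopology ?T S closure_of D = S"
      unfolding closure_of_subtopology Int_absorb1[OF DS] by blast
    show "density (subtopology (pointwise_topology Y E) S) \<le>o hereditary_lindelof_star Y"
      unfolding sub
    proof (rule density_le)
      show "D \<subseteq> topspace (subtopology ?T S)"
        "subtopology ?T S closure_of D = topspace (subtopology ?T S)"
        unfolding topspace_subtopology_subset[OF Stop] by (fact DS dense)+
    qed (fact card hereditary_lindelof_star_props)+
  qed
qed

section \<open>Covers of powers of the Baire space from dense sets of functions\<close>

definition box_code :: "nat \<Rightarrow> (nat \<Rightarrow> 'a set) \<Rightarrow> 'a \<Rightarrow> real" where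
  "box_code n Z x = (\<Sum>i<n. real (2 ^ i) * indicator (Z i) x)"

text \<open>
  A sum of distinct powers of \<open>2\<close> determines its exponents; \<^const>\<open>set_encode\<close> is the binary coding
  of finite sets of naturals, which is injective.
\<close>

lemma box_code_eq_set_encode: "box_code n Z x = real (set_encode {i. i < n \<and> x \<in> Z i})"
proof -
  have "box_code n Z x = (\<Sum>i | i < n \<and> x \<in> Z i. 2 ^ i)"
    unfolding box_code_def by (rule sum.mono_neutral_cong_right) (auto simp: indicator_def)
  then show ?thesis
    by (simp add: set_encode_def)
qed

lemma box_code_close_imp_mem:
  assumes "\<bar>box_code n Z x - box_code n Z' x\<bar> < 1" "i < n" "x \<in> Z' i"
  shows "x \<in> Z i"
proof -
  have "set_encode {i. i < n \<and> x \<in> Z i} = set_encode {i. i < n \<and> x \<in> Z' i}"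
    using assms(1) unfolding box_code_eq_set_encode by linarith
  then have "{i. i < n \<and> x \<in> Z i} = {i. i < n \<and> x \<in> Z' i}"
    by (subst (asm) set_encode_eq) auto
  then show ?thesis using assms(2,3) by blast
qed

lemma box_code_in_L_functions:
  assumes "n \<ge> 1" "\<And>i. i < n \<Longrightarrow> Z i \<in> zero_sets X"
  shows "restrict (box_code n Z) (topspace X) \<in> L_functions X"
  unfolding L_functions_def box_code_def
  by (rule CollectI, rule exI[of _ n], rule exI[of _ "\<lambda>i. 2 ^ i"], rule exI[of _ Z])
    (use assms in simp)

lemma baire_power_zero_set_box:
  assumes "openin (power_space (baire_space X) n) W" "a \<in> W"
  obtains Z where "\<And>i. i < n \<Longrightarrow> Z i \<in> zero_sets X" "a \<in> PiE {..<n} Z" "PiE {..<n} Z \<subseteq> W"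
proof -
  obtain V where V: "a \<in> PiE {..<n} V" "\<And>i. openin (baire_space X) (V i)" "PiE {..<n} V \<subseteq> W"
    using product_topology_open_contains_basis[OF assms[unfolded power_space_def]] by auto
  have "\<exists>Z. Z \<in> zero_sets X \<and> a i \<in> Z \<and> Z \<subseteq> V i" if "i < n" for i
    using V(2)[of i] PiE_mem[OF V(1), of i] that
    unfolding openin_baire_space arbitrary_union_of_alt by auto
  then obtain Z where Z: "\<And>i. i < n \<Longrightarrow> Z i \<in> zero_sets X \<and> a i \<in> Z i \<and> Z i \<subseteq> V i"
    by metis
  show thesis
  proof (rule that[of Z])
    show "a \<in> PiE {..<n} Z" using V(1) Z by (auto simp: PiE_iff)
    show "PiE {..<n} Z \<subseteq> W"
      by (rule order_trans[OF PiE_mono V(3)]) (use Z in simp)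
  qed (use Z in blast)
qed

text \<open>
  A refinement by zero-set boxes turns covering into coding: since the codes are integer-valued, the
  neighbourhood of radius \<open>1\<close> around the code of the box at \<open>b\<close>, tested at the coordinates of \<open>b\<close>,
  contains only codes of boxes that contain \<open>b\<close>. Any dense set of codes therefore yields a subcover.
\<close>

lemma lindelof_number_baire_power_le:
  fixes X :: "'a topology"
  assumes L: "L_functions X \<subseteq> E" and n: "n \<ge> 1"
    and A: "A \<subseteq> topspace (power_space (baire_space X) n)"
  shows "lindelof_number (subtopology (power_space (baire_space X) n) A)
    \<le>o hereditary_density (pointwise_topology X E)"
proof (rule lindelof_number_least)
  let ?P = "power_space (baire_space X) n" and ?T = "pointwise_topology X E"
  let ?\<kappa> = "hereditary_density ?T"
  show "Card_order ?\<kappa>" "natLeq \<le>o ?\<kappa>"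
    by (rule hereditary_density_props)+
  fix \<U> assume op: "\<And>U. U \<in> \<U> \<Longrightarrow> openin (subtopology ?P A) U"
    and cover: "\<Union>\<U> = topspace (subtopology ?P A)"
  have top: "topspace (subtopology ?P A) = A"
    using A by (rule topspace_subtopology_subset)
  have "\<exists>U Z. U \<in> \<U> \<and> (\<forall>i<n. Z i \<in> zero_sets X) \<and> a \<in> PiE {..<n} Z \<and> PiE {..<n} Z \<inter> A \<subseteq> U"
    if a: "a \<in> A" for a
  proof -
    obtain U where U: "U \<in> \<U>" "a \<in> U"
      using a cover[unfolded top] by blast
    obtain W where W: "openin ?P W" "U = W \<inter> A"
      using op[OF U(1)] unfolding openin_subtopology by blast
    with U obtain Z where "\<And>i. i < n \<Longrightarrow> Z i \<in> zero_sets X" "a \<in> PiE {..<n} Z" "PiE {..<n} Z \<subseteq> W"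
      using baire_power_zero_set_box[of X n W a] by blast
    then show ?thesis using U(1) W(2) by blast
  qed
  then obtain U Z where U: "\<And>a. a \<in> A \<Longrightarrow> U a \<in> \<U>"
    and Z: "\<And>a i. \<lbrakk>a \<in> A; i < n\<rbrakk> \<Longrightarrow> Z a i \<in> zero_sets X" "\<And>a. a \<in> A \<Longrightarrow> a \<in> PiE {..<n} (Z a)"
    and ZU: "\<And>a. a \<in> A \<Longrightarrow> PiE {..<n} (Z a) \<inter> A \<subseteq> U a"
    by metis
  define F where "F a = restrict (box_code n (Z a)) (topspace X)" for a
  have "F a \<in> L_functions X" if "a \<in> A" for a
    unfolding F_def using n Z(1)[OF that] by (rule box_code_in_L_functions)
  then have "F ` A \<subseteq> topspace ?T"
    using L by (auto simp: pointwise_topology_def F_def)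
  then obtain D where D: "D \<subseteq> F ` A" "|D| \<le>o ?\<kappa>" "F ` A \<subseteq> ?T closure_of D"
    by (rule hereditary_density_dense_subset)
  then obtain A' where A': "A' \<subseteq> A" "inj_on F A'" "D = F ` A'"
    unfolding subset_image_inj by blast
  \<comment> \<open>A code may come from several points; one point for each code in \<open>D\<close> keeps the subcover small.\<close>
  have "|A'| \<le>o |D|"
    using A' card_of_ordLeq[of A' D] by blast
  from ordLeq_transitive[OF card_of_image ordLeq_transitive[OF this D(2)]]
  have card: "|U ` A'| \<le>o ?\<kappa>" .
  have "b \<in> \<Union>(U ` A')" if b: "b \<in> A" for b
  proof -
    have bX: "b i \<in> topspace X" if "i < n" for i
      using b A that by (auto simp: power_space_def topspace_baire_space PiE_iff)
    define N where "N = {g \<in> topspace ?T. \<forall>i<n. g (b i) \<in> ball (F b (b i)) 1}"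
    have "openin ?T {g \<in> topspace ?T. g (b i) \<in> ball (F b (b i)) 1}" if "i < n" for i
    proof (rule openin_continuous_map_preimage)
      show "continuous_map ?T euclideanreal (\<lambda>g. g (b i))"
        unfolding pointwise_topology_def
        by (intro continuous_map_from_subtopology continuous_map_product_projection bX that)
    qed (simp flip: open_openin)
    moreover have "0 \<in> {..<n}" using n by simp
    moreover from this have "N = (\<Inter>i\<in>{..<n}. {g \<in> topspace ?T. g (b i) \<in> ball (F b (b i)) 1})"
      unfolding N_def by blast
    ultimately have "openin ?T N"
      by (metis (no_types, lifting) openin_INT2 finite_lessThan lessThan_iff empty_iff)
    moreover have "F b \<in> ?T closure_of D" using D(3) b by blast
    moreover from this have "F b \<in> N"
      using closure_of_subset_topspace[of ?T D] by (auto simp: N_def)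
    ultimately obtain g where "g \<in> D" "g \<in> N"
      unfolding in_closure_of by blast
    then obtain a where a: "a \<in> A'" "F a \<in> N" using A'(3) by blast
    have "b i \<in> Z a i" if "i < n" for i
    proof (rule box_code_close_imp_mem[OF _ that])
      show "b i \<in> Z b i" using Z(2)[OF b] that by auto
      show "\<bar>box_code n (Z a) (b i) - box_code n (Z b) (b i)\<bar> < 1"
        using a(2) that bX[OF that] by (auto simp: N_def F_def dist_real_def abs_minus_commute)
    qed
    then have "b \<in> PiE {..<n} (Z a)"
      using Z(2)[OF b] by (auto simp: PiE_iff)
    then show ?thesis using ZU a(1) A'(1) b by blast
  qed
  moreover have "U ` A' \<subseteq> \<U>" using U A'(1) by blast
  ultimately show "\<exists>\<V>. |\<V>| \<le>o ?\<kappa> \<and> \<V> \<subseteq> \<U> \<and> \<Union>\<V> = topspace (subtopology ?P A)"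
    using card cover top by (intro exI[of _ "U ` A'"]) blast
qed

theorem hereditary_lindelof_star_le_hereditary_density:
  assumes "L_functions X \<subseteq> E"
  shows "hereditary_lindelof_star (baire_space X) \<le>o hereditary_density (pointwise_topology X E)"
  unfolding hereditary_lindelof_star_def
proof (rule card_sup_least)
  let ?Y = "baire_space X" and ?\<kappa> = "hereditary_density (pointwise_topology X E)"
  show "Card_order ?\<kappa>" by (rule hereditary_density_props)
  show "\<forall>r\<in>{hereditary_lindelof (power_space ?Y n) |n. n \<ge> 1}. Card_order r"
    using hereditary_lindelof_props(1) by blast
  have "hereditary_lindelof (power_space ?Y n) \<le>o ?\<kappa>" if "n \<ge> 1" for n
    unfolding hereditary_lindelof_def
  proof (rule card_sup_least)
    show "Card_order ?\<kappa>" by (rule hereditary_density_props)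
  qed (use lindelof_number_props(1) lindelof_number_baire_power_le[OF assms that] in blast)+
  then show "\<forall>r\<in>{hereditary_lindelof (power_space ?Y n) |n. n \<ge> 1}. r \<le>o ?\<kappa>"
    by blast
qed

theorem theorem3p2:
  fixes X :: "'a topology" and E :: "('a \<Rightarrow> real) set"
  assumes "tychonoff_space X"
    and "L_functions X \<subseteq> E"
    and "E \<subseteq> continuous_functions (baire_space X)"
  shows "hereditary_density (pointwise_topology X E) =o hereditary_lindelof_star (baire_space X)"
proof -
  have "pointwise_topology X E = pointwise_topology (baire_space X) E"
    by (simp add: pointwise_topology_def topspace_baire_space)
  then have "hereditary_density (pointwise_topology X E) \<le>o hereditary_lindelof_star (baire_space X)"
    using hereditary_density_le_hereditary_lindelof_star[OF assms(3)] by simp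
  then show ?thesis
    using hereditary_lindelof_star_le_hereditary_density[OF assms(2)] by (simp add: ordIso_iff_ordLeq)
qed

end
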